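(* Let $1<p<2$ and let $\{\varepsilon_k:k\in\mathbb Z\}$ be independent and identically distributed real random variables such that $x^p\Pr\{|\varepsilon_0|>x\}\to0$ as $x\to\infty$ and $\operatorname E\varepsilon_0=0$. Let $1/p<d<1$ and let $\psi_j=(j+1)^{-d}$ for $j\ge0$. Then $$\frac{S_n}{n^{1/p+1-d}}\to0\quad\text{in probability as } n\to\infty.$$
   Context: The linear process $\{X_k:k\in\mathbb Z\}$ is defined by the almost surely convergent series $X_k=\sum_{j=0}^\infty\psi_j\varepsilon_{k-j}$, and $S_n=\sum_{k=1}^nX_k$ for $n\ge1$. *)

theory Defs
  imports "HOL-Probability.Probability"
begin

text \<open>
  On the event where the series diverges, \<^const>\<open>suminf\<close> returns an unspecified value. This does
  not affect statements up to null sets once the series is known to converge almost surely.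
\<close>

definition linear_process :: "(nat \<Rightarrow> real) \<Rightarrow> (int \<Rightarrow> 'a \<Rightarrow> real) \<Rightarrow> int \<Rightarrow> 'a \<Rightarrow> real" where
  "linear_process \<psi> \<epsilon> k \<omega> = (\<Sum>j. \<psi> j * \<epsilon> (k - int j) \<omega>)"

definition partial_sum :: "(int \<Rightarrow> 'a \<Rightarrow> real) \<Rightarrow> nat \<Rightarrow> 'a \<Rightarrow> real" where
  "partial_sum X n \<omega> = (\<Sum>k=1..n. X (int k) \<omega>)"

text \<open>
  Measurability is part of the definition because \<^const>\<open>measure\<close> is 0 on non-measurable sets.
\<close>

definition tendsto_in_prob :: "'a measure \<Rightarrow> (nat \<Rightarrow> 'a \<Rightarrow> real) \<Rightarrow> ('a \<Rightarrow> real) \<Rightarrow> bool" where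
  "tendsto_in_prob M Y Z \<longleftrightarrow>
     (\<forall>n. Y n \<in> borel_measurable M) \<and> Z \<in> borel_measurable M \<and>
     (\<forall>e>0. (\<lambda>n. measure M {\<omega> \<in> space M. \<bar>Y n \<omega> - Z \<omega>\<bar> > e}) \<longlonglongrightarrow> 0)"

end

theory Submission
  imports Defs "HOL-Real_Asymp.Real_Asymp"
begin

text \<open>
  The idea is to measure a random variable \<open>W\<close> by \<open>E (quad_lin W)\<close>, where \<open>quad_lin w\<close> is the minimum
  of \<open>w\<^sup>2\<close> and \<open>\<bar>w\<bar>\<close>. Truncating independent centered variables \<open>W i\<close> at level one and recentering
  leaves bounded parts, whose variances add up, and remainders, which are estimated in \<open>L\<^sup>1\<close>; both are
  governed by \<open>S = (\<Sum>i. E (quad_lin (W i)))\<close>. If \<open>S\<close> is finite, the series of the \<open>W i\<close> converges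
  almost surely (\<open>AE_summable_of_summable_quad_lin\<close>, through Kolmogorov's maximal inequality), and
  finite sums satisfy \<open>E \<bar>\<Sum>i. W i\<bar> \<le> sqrt S + 2 * S\<close> (\<open>expectation_abs_sum_le_quad_lin\<close>).

  The tail condition on the innovations says precisely enough about weighted innovations:
  \<open>E (quad_lin (c * \<epsilon> 0)) = o(c powr p)\<close> as \<open>c\<close> decreases to zero (\<open>quad_lin_moment_scaling\<close>). Since
  \<open>\<psi> j powr p = (j + 1) powr - (d * p)\<close> is summable when \<open>1 / p < d\<close>, the series defining the linear
  process converges almost surely.

  For the partial sums, collect the coefficient of each innovation: the normalised sum is
  \<open>\<Sum>i. c n i * \<epsilon> i\<close> with nonnegative weights. The normalisation \<open>n powr (1 / p + 1 - d)\<close> is the one for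
  which \<open>\<Sum>i. c n i powr p\<close> stays bounded by a constant \<open>C\<close> (\<open>sum_window_weight_powr_le\<close>), while the
  largest weight is of order \<open>n powr (- 1 / p)\<close> and tends to zero (\<open>window_weight_le\<close>). Hence for every
  \<open>\<eta> > 0\<close> and all large \<open>n\<close> the quantity \<open>S\<close> of the weighted innovations is at most \<open>\<eta> * C\<close>, so the
  first absolute moment of the normalised sum tends to zero, and Markov's inequality concludes. The
  moment bound is proved for finitely many innovations, uniformly in their number, and carried to the
  infinite series by Fatou's lemma (\<open>prob_abs_limit_gt_le\<close>).
\<close>

section \<open>Independent centered square-integrable variables\<close>

text \<open>
  This serves to pass to a tail of a sequence, and to view the innovations backwards from a fixed
  time as a sequence indexed by \<open>nat\<close>. Evaluating the restriction of the family to the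
  singleton \<open>{f j}\<close> recovers the single variable.
\<close>
lemma (in prob_space) indep_vars_reindex_inj:
  assumes "indep_vars M' X I" "inj_on f J" "f ` J \<subseteq> I"
  shows "indep_vars (\<lambda>j. M' (f j)) (\<lambda>j. X (f j)) J"
proof -
  have "indep_vars (\<lambda>j. PiM {f j} M') (\<lambda>j \<omega>. restrict (\<lambda>i. X i \<omega>) {f j}) J"
    using assms by (intro indep_vars_restrict) (auto simp: disjoint_family_on_def inj_on_def)
  then have "indep_vars (\<lambda>j. M' (f j)) (\<lambda>j \<omega>. (\<lambda>x. x (f j)) (restrict (\<lambda>i. X i \<omega>) {f j})) J"
    by (rule indep_vars_compose2) (rule measurable_component_singleton, simp)
  then show ?thesis by simp
qed

text \<open>
  Cross terms of distinct summands vanish, since one summand is independent of the sum of the others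
  and has mean zero.
\<close>
lemma (in prob_space) second_moment_sum_indep_centered:
  fixes X :: "'i \<Rightarrow> 'a \<Rightarrow> real"
  assumes "finite I" and ind: "indep_vars (\<lambda>_. borel) X I"
    and int: "\<And>i. i \<in> I \<Longrightarrow> integrable M (X i)"
    and sq: "\<And>i. i \<in> I \<Longrightarrow> integrable M (\<lambda>\<omega>. (X i \<omega>)\<^sup>2)"
    and mean: "\<And>i. i \<in> I \<Longrightarrow> expectation (X i) = 0"
  shows "integrable M (\<lambda>\<omega>. (\<Sum>i\<in>I. X i \<omega>)\<^sup>2) \<and>
    expectation (\<lambda>\<omega>. (\<Sum>i\<in>I. X i \<omega>)\<^sup>2) = (\<Sum>i\<in>I. expectation (\<lambda>\<omega>. (X i \<omega>)\<^sup>2))"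
  using assms
proof (induction I rule: finite_induct)
  case empty
  then show ?case by simp
next
  case (insert i I)
  have sub: "indep_vars (\<lambda>_. borel) X I"
    by (rule indep_vars_subset[OF insert.prems(1)]) auto
  have IH: "integrable M (\<lambda>\<omega>. (\<Sum>i\<in>I. X i \<omega>)\<^sup>2)"
    "expectation (\<lambda>\<omega>. (\<Sum>i\<in>I. X i \<omega>)\<^sup>2) = (\<Sum>i\<in>I. expectation (\<lambda>\<omega>. (X i \<omega>)\<^sup>2))"
    using insert.IH[OF sub] insert.prems by auto
  have iv: "indep_var borel (X i) borel (\<lambda>\<omega>. \<Sum>i\<in>I. X i \<omega>)"
    using insert by (intro indep_vars_sum) auto
  have intS: "integrable M (\<lambda>\<omega>. \<Sum>i\<in>I. X i \<omega>)" using insert.prems by auto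
  have prod_int: "integrable M (\<lambda>\<omega>. X i \<omega> * (\<Sum>i\<in>I. X i \<omega>))"
    by (rule indep_var_integrable[OF iv]) (use insert.prems intS in auto)
  have prod0: "expectation (\<lambda>\<omega>. X i \<omega> * (\<Sum>i\<in>I. X i \<omega>)) = 0"
    by (subst indep_var_lebesgue_integral[OF iv]) (use insert.prems intS in auto)
  have exp: "(\<Sum>i\<in>insert i I. X i \<omega>)\<^sup>2
    = (X i \<omega>)\<^sup>2 + (2 * (X i \<omega> * (\<Sum>i\<in>I. X i \<omega>)) + (\<Sum>i\<in>I. X i \<omega>)\<^sup>2)" for \<omega>
    using insert.hyps by (simp add: power2_sum algebra_simps)
  have sqi: "integrable M (\<lambda>\<omega>. (X i \<omega>)\<^sup>2)" using insert.prems by auto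
  show ?case
    unfolding exp using insert.hyps sqi prod_int IH prod0 by auto
qed

text \<open>
  The partial sums of \<open>x\<close>, frozen from the first time on at which their modulus reaches \<open>l\<close>.
\<close>
primrec stopped_sum :: "real \<Rightarrow> (nat \<Rightarrow> real) \<Rightarrow> nat \<Rightarrow> real" where
  "stopped_sum l x 0 = 0"
| "stopped_sum l x (Suc n) = stopped_sum l x n + (if \<bar>stopped_sum l x n\<bar> < l then x n else 0)"

text \<open>
  As long as the level \<open>l\<close> has not been reached nothing is frozen; once it has been reached, the
  stopped sum keeps a value of modulus at least \<open>l\<close>. So the running maximum of the partial sums is
  controlled by the single value \<open>stopped_sum l x n\<close>.
\<close>
lemma stopped_sum_eq_or_exceeds:
  "l \<le> \<bar>stopped_sum l x n\<bar> \<or>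
   stopped_sum l x n = (\<Sum>i<n. x i) \<and> (\<forall>m\<le>n. \<bar>\<Sum>i<m. x i\<bar> < l)"
proof (induction n)
  case 0
  then show ?case by auto
next
  case (Suc n)
  then show ?case by (auto simp: le_Suc_eq)
qed

lemma exceeds_imp_stopped_sum_exceeds:
  assumes "m \<le> n" "l \<le> \<bar>\<Sum>i<m. x i\<bar>"
  shows "l \<le> \<bar>stopped_sum l x n\<bar>"
  using stopped_sum_eq_or_exceeds[of l x n] assms by force

text \<open>
  The stopped sum at time \<open>n\<close> depends only on the first \<open>n\<close> terms; together with the measurability
  in these terms this makes it independent of the next summand.
\<close>
lemma stopped_sum_restrict: "n \<le> m \<Longrightarrow> stopped_sum l (restrict x {..<m}) n = stopped_sum l x n"
  by (induction n) auto

lemma measurable_stopped_sum: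
  "n \<le> m \<Longrightarrow> (\<lambda>x. stopped_sum l x n) \<in> borel_measurable (PiM {..<m} (\<lambda>_. borel))"
  by (induction n) (auto intro!: borel_measurable_add measurable_If)

lemma (in prob_space) indep_var_stopped_sum:
  assumes "indep_vars (\<lambda>_. borel) X (UNIV :: nat set)"
  shows "indep_var borel (\<lambda>\<omega>. stopped_sum l (\<lambda>i. X i \<omega>) n) borel (X n)"
proof -
  have "indep_var borel ((\<lambda>x. stopped_sum l x n) \<circ> (\<lambda>\<omega>. restrict (\<lambda>i. X i \<omega>) {..<n}))
    borel ((\<lambda>x. x n) \<circ> (\<lambda>\<omega>. restrict (\<lambda>i. X i \<omega>) {n}))"
    by (intro indep_var_compose[OF indep_var_restrict[OF assms]] measurable_stopped_sum) auto
  then show ?thesis by (simp add: comp_def stopped_sum_restrict)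
qed

text \<open>
  The stopped sum is the martingale transform of the partial sums by a predictable sequence of zeros
  and ones: the increment at time \<open>n\<close> is \<open>X n\<close> times an indicator that is independent of \<open>X n\<close>.
  Hence the increments are orthogonal, and each has second moment at most that of \<open>X n\<close>.
\<close>
lemma (in prob_space) second_moment_stopped_sum:
  fixes X :: "nat \<Rightarrow> 'a \<Rightarrow> real"
  assumes ind: "indep_vars (\<lambda>_. borel) X UNIV"
    and int: "\<And>i. integrable M (X i)"
    and sq: "\<And>i. integrable M (\<lambda>\<omega>. (X i \<omega>)\<^sup>2)"
    and mean: "\<And>i. expectation (X i) = 0"
  shows "integrable M (\<lambda>\<omega>. (stopped_sum l (\<lambda>i. X i \<omega>) n)\<^sup>2) \<and>
    expectation (\<lambda>\<omega>. (stopped_sum l (\<lambda>i. X i \<omega>) n)\<^sup>2) \<le> (\<Sum>i<n. expectation (\<lambda>\<omega>. (X i \<omega>)\<^sup>2))"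
proof (induction n)
  case 0
  then show ?case by simp
next
  case (Suc n)
  define T where "T \<omega> = stopped_sum l (\<lambda>i. X i \<omega>) n" for \<omega>
  \<comment> \<open>The indicator that the level has not been reached up to time \<open>n\<close>.\<close>
  define A where "A \<omega> = (if \<bar>T \<omega>\<bar> < l then 1 else 0 :: real)" for \<omega>
  have iv: "indep_var borel T borel (X n)"
    unfolding T_def by (rule indep_var_stopped_sum[OF ind])
  have [measurable]: "T \<in> borel_measurable M" "X n \<in> borel_measurable M"
    using indep_var_rv1[OF iv] indep_var_rv2[OF iv] by auto
  have A_meas [measurable]: "A \<in> borel_measurable M" unfolding A_def by measurable
  have intTA: "integrable M (\<lambda>\<omega>. T \<omega> * A \<omega>)"
    by (rule integrable_const_bound[of _ "\<bar>l\<bar>"]) (auto simp: A_def)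
  have "indep_var borel ((\<lambda>t. t * (if \<bar>t\<bar> < l then 1 else 0)) \<circ> T) borel ((\<lambda>x. x) \<circ> X n)"
    by (rule indep_var_compose[OF iv]) auto
  then have iv2: "indep_var borel (\<lambda>\<omega>. T \<omega> * A \<omega>) borel (X n)"
    by (simp add: comp_def A_def)
  have cross_int: "integrable M (\<lambda>\<omega>. T \<omega> * A \<omega> * X n \<omega>)"
    by (rule indep_var_integrable[OF iv2 intTA int])
  have cross: "expectation (\<lambda>\<omega>. T \<omega> * A \<omega> * X n \<omega>) = 0"
    by (subst indep_var_lebesgue_integral[OF iv2 intTA int]) (simp add: mean)
  have AXint: "integrable M (\<lambda>\<omega>. A \<omega> * (X n \<omega>)\<^sup>2)"
    by (rule Bochner_Integration.integrable_bound[OF sq[of n]]) (auto simp: A_def)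
  have AX: "expectation (\<lambda>\<omega>. A \<omega> * (X n \<omega>)\<^sup>2) \<le> expectation (\<lambda>\<omega>. (X n \<omega>)\<^sup>2)"
    by (rule integral_mono[OF AXint sq]) (auto simp: A_def)
  have eq: "(stopped_sum l (\<lambda>i. X i \<omega>) (Suc n))\<^sup>2
     = (T \<omega>)\<^sup>2 + (2 * (T \<omega> * A \<omega> * X n \<omega>) + A \<omega> * (X n \<omega>)\<^sup>2)" for \<omega>
    by (simp add: T_def[symmetric] A_def power2_sum)
  have IH: "integrable M (\<lambda>\<omega>. (T \<omega>)\<^sup>2)"
    "expectation (\<lambda>\<omega>. (T \<omega>)\<^sup>2) \<le> (\<Sum>i<n. expectation (\<lambda>\<omega>. (X i \<omega>)\<^sup>2))"
    using Suc unfolding T_def by auto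
  show ?case unfolding eq using IH cross_int cross AXint AX by auto
qed

text \<open>
  Chebyshev's inequality for the stopped sum, which is at least \<open>l\<close> in modulus whenever one of the
  partial sums is.
\<close>
lemma (in prob_space) kolmogorov_maximal_inequality:
  fixes X :: "nat \<Rightarrow> 'a \<Rightarrow> real"
  assumes ind: "indep_vars (\<lambda>_. borel) X UNIV"
    and int: "\<And>i. integrable M (X i)"
    and sq: "\<And>i. integrable M (\<lambda>\<omega>. (X i \<omega>)\<^sup>2)"
    and mean: "\<And>i. expectation (X i) = 0"
    and "0 < l"
  shows "prob {\<omega> \<in> space M. \<exists>m\<le>n. l \<le> \<bar>\<Sum>i<m. X i \<omega>\<bar>}
    \<le> (\<Sum>i<n. expectation (\<lambda>\<omega>. (X i \<omega>)\<^sup>2)) / l\<^sup>2"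
proof -
  define T where "T \<omega> = stopped_sum l (\<lambda>i. X i \<omega>) n" for \<omega>
  have [measurable]: "T \<in> borel_measurable M"
    unfolding T_def using indep_var_rv1[OF indep_var_stopped_sum[OF ind]] by auto
  note T = second_moment_stopped_sum[OF ind int sq mean, of l n, folded T_def]
  have "prob {\<omega> \<in> space M. \<exists>m\<le>n. l \<le> \<bar>\<Sum>i<m. X i \<omega>\<bar>} \<le> prob {\<omega> \<in> space M. l\<^sup>2 \<le> (T \<omega>)\<^sup>2}"
  proof (rule finite_measure_mono)
    have "l\<^sup>2 \<le> (T \<omega>)\<^sup>2" if "m \<le> n" "l \<le> \<bar>\<Sum>i<m. X i \<omega>\<bar>" for \<omega> m
      using exceeds_imp_stopped_sum_exceeds[OF that] \<open>0 < l\<close>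
      by (simp add: T_def abs_le_square_iff[symmetric])
    then show "{\<omega> \<in> space M. \<exists>m\<le>n. l \<le> \<bar>\<Sum>i<m. X i \<omega>\<bar>} \<subseteq> {\<omega> \<in> space M. l\<^sup>2 \<le> (T \<omega>)\<^sup>2}"
      by auto
  qed simp
  also have "\<dots> \<le> expectation (\<lambda>\<omega>. (T \<omega>)\<^sup>2) / l\<^sup>2"
    using T \<open>0 < l\<close> by (intro integral_Markov_inequality_measure[where A="{}"]) auto
  also have "\<dots> \<le> (\<Sum>i<n. expectation (\<lambda>\<omega>. (X i \<omega>)\<^sup>2)) / l\<^sup>2"
    using T by (intro divide_right_mono) auto
  finally show ?thesis .
qed

text \<open>
  The maximal inequality over an infinite horizon, by continuity of the measure from below.
\<close>
lemma (in prob_space) prob_some_partial_sum_exceeds_le: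
  fixes X :: "nat \<Rightarrow> 'a \<Rightarrow> real"
  assumes ind: "indep_vars (\<lambda>_. borel) X UNIV"
    and int: "\<And>i. integrable M (X i)"
    and sq: "\<And>i. integrable M (\<lambda>\<omega>. (X i \<omega>)\<^sup>2)"
    and mean: "\<And>i. expectation (X i) = 0"
    and "0 < l" and summ: "summable (\<lambda>i. expectation (\<lambda>\<omega>. (X i \<omega>)\<^sup>2))"
  shows "prob {\<omega> \<in> space M. \<exists>m. l \<le> \<bar>\<Sum>i<m. X i \<omega>\<bar>}
    \<le> (\<Sum>i. expectation (\<lambda>\<omega>. (X i \<omega>)\<^sup>2)) / l\<^sup>2"
proof -
  have [measurable]: "X i \<in> borel_measurable M" for i using int by auto
  define E where "E n = {\<omega> \<in> space M. \<exists>m\<le>n. l \<le> \<bar>\<Sum>i<m. X i \<omega>\<bar>}" for n :: nat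
  have E: "E n \<in> events" for n unfolding E_def by measurable
  have "incseq E" unfolding incseq_def E_def by (auto intro: order_trans)
  then have "(\<lambda>n. prob (E n)) \<longlonglongrightarrow> prob (\<Union>n. E n)"
    using E by (intro finite_Lim_measure_incseq) auto
  moreover have "prob (E n) \<le> (\<Sum>i. expectation (\<lambda>\<omega>. (X i \<omega>)\<^sup>2)) / l\<^sup>2" for n
  proof -
    have "prob (E n) \<le> (\<Sum>i<n. expectation (\<lambda>\<omega>. (X i \<omega>)\<^sup>2)) / l\<^sup>2"
      unfolding E_def by (rule kolmogorov_maximal_inequality[OF ind int sq mean \<open>0 < l\<close>])
    also have "\<dots> \<le> (\<Sum>i. expectation (\<lambda>\<omega>. (X i \<omega>)\<^sup>2)) / l\<^sup>2"
      by (intro divide_right_mono sum_le_suminf[OF summ]) auto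
    finally show ?thesis .
  qed
  ultimately have "prob (\<Union>n. E n) \<le> (\<Sum>i. expectation (\<lambda>\<omega>. (X i \<omega>)\<^sup>2)) / l\<^sup>2"
    by (intro LIMSEQ_le_const2) auto
  moreover have "(\<Union>n. E n) = {\<omega> \<in> space M. \<exists>m. l \<le> \<bar>\<Sum>i<m. X i \<omega>\<bar>}"
    unfolding E_def by auto
  ultimately show ?thesis by simp
qed

text \<open>
  The maximal inequality for the tails of the series: the probability that the partial sums move by
  more than \<open>l\<close> after time \<open>n\<close> is at most a multiple of the tail \<open>\<Sum>i. v (i + n)\<close>, which vanishes
  as \<open>n\<close> grows. So almost surely the partial sums are Cauchy.
\<close>
lemma (in prob_space) AE_summable_of_summable_variance:
  fixes X :: "nat \<Rightarrow> 'a \<Rightarrow> real"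
  assumes ind: "indep_vars (\<lambda>_. borel) X UNIV"
    and int: "\<And>i. integrable M (X i)"
    and sq: "\<And>i. integrable M (\<lambda>\<omega>. (X i \<omega>)\<^sup>2)"
    and mean: "\<And>i. expectation (X i) = 0"
    and summ: "summable (\<lambda>i. expectation (\<lambda>\<omega>. (X i \<omega>)\<^sup>2))"
  shows "AE \<omega> in M. summable (\<lambda>i. X i \<omega>)"
proof -
  have [measurable]: "X i \<in> borel_measurable M" for i using int by auto
  define v where "v i = expectation (\<lambda>\<omega>. (X i \<omega>)\<^sup>2)" for i
  define E where "E l n = {\<omega> \<in> space M. \<exists>m. l \<le> \<bar>\<Sum>i<m. X (i + n) \<omega>\<bar>}" for l :: real and n :: nat
  have E [measurable]: "E l n \<in> events" for l n unfolding E_def by measurable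
  have tail: "prob (E l n) \<le> (\<Sum>i. v (i + n)) / l\<^sup>2" if "0 < l" for l n
  proof -
    have "indep_vars (\<lambda>_. borel) (\<lambda>i. X (i + n)) UNIV"
      by (rule indep_vars_reindex_inj[OF ind]) auto
    moreover have "summable (\<lambda>i. v (i + n))"
      using summ unfolding v_def by (subst summable_iff_shift)
    ultimately show ?thesis
      unfolding E_def v_def using int sq mean that
      by (intro prob_some_partial_sum_exceeds_le) auto
  qed
  have null: "prob (\<Inter>n. E l n) = 0" if "0 < l" for l
  proof -
    have "(\<lambda>n. (\<Sum>i. v (i + n)) / l\<^sup>2) \<longlonglongrightarrow> 0 / l\<^sup>2"
      using summ unfolding v_def by (intro tendsto_divide suminf_exist_split2) (use that in auto)
    moreover have "prob (\<Inter>n. E l n) \<le> (\<Sum>i. v (i + n)) / l\<^sup>2" for n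
      by (rule order_trans[OF finite_measure_mono tail[OF that]]) auto
    ultimately have "prob (\<Inter>n. E l n) \<le> 0"
      by (intro LIMSEQ_le_const[of _ 0]) auto
    then show ?thesis using measure_nonneg[of M "\<Inter>n. E l n"] by linarith
  qed
  have "AE \<omega> in M. \<forall>j. \<omega> \<notin> (\<Inter>n. E (1 / real (Suc j)) n)"
  proof (subst AE_all_countable, rule allI)
    fix j :: nat
    have "emeasure M (\<Inter>n. E (1 / real (Suc j)) n) = 0"
      using null[of "1 / real (Suc j)"] by (simp add: emeasure_eq_measure)
    then show "AE \<omega> in M. \<omega> \<notin> (\<Inter>n. E (1 / real (Suc j)) n)"
      by (intro AE_not_in null_setsI) auto
  qed
  then show ?thesis
  proof (rule AE_mp, intro AE_I2 impI)
    fix \<omega> assume \<omega>: "\<omega> \<in> space M" and *: "\<forall>j. \<omega> \<notin> (\<Inter>n. E (1 / real (Suc j)) n)"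
    show "summable (\<lambda>i. X i \<omega>)"
      unfolding summable_Cauchy
    proof (intro allI impI)
      fix e :: real assume "0 < e"
      then obtain j where j: "1 / real (Suc j) < e / 2"
        using nat_approx_posE[of "e/2"] by auto
      obtain n0 where "\<omega> \<notin> E (1 / real (Suc j)) n0" using * by blast
      then have "\<not> 1 / real (Suc j) \<le> \<bar>\<Sum>i<m. X (i + n0) \<omega>\<bar>" for m
        using \<omega> unfolding E_def by blast
      then have n0: "\<bar>\<Sum>i<m. X (i + n0) \<omega>\<bar> < e / 2" for m
        using j by (meson less_trans not_le)
      show "\<exists>N. \<forall>m\<ge>N. \<forall>n. norm (\<Sum>i = m..<n. X i \<omega>) < e"
      proof (intro exI[of _ n0] allI impI)
        fix m n assume "n0 \<le> m"
        show "norm (\<Sum>i = m..<n. X i \<omega>) < e"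
        proof (cases "m \<le> n")
          case True
          have shift: "(\<Sum>i<k - n0. X (i + n0) \<omega>) = (\<Sum>i = n0..<k. X i \<omega>)" if "n0 \<le> k" for k
            using that sum.shift_bounds_nat_ivl[of "\<lambda>i. X i \<omega>" 0 n0 "k - n0"]
            by (simp add: atLeast0LessThan)
          have "(\<Sum>i = m..<n. X i \<omega>) = (\<Sum>i<n - n0. X (i + n0) \<omega>) - (\<Sum>i<m - n0. X (i + n0) \<omega>)"
            using shift[of m] shift[of n] True \<open>n0 \<le> m\<close>
              sum.atLeastLessThan_concat[of n0 m n "\<lambda>i. X i \<omega>"] by simp
          then show ?thesis
            using n0[of "n - n0"] n0[of "m - n0"] unfolding real_norm_def by linarith
        qed (use \<open>0 < e\<close> in simp)
      qed
    qed
  qed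
qed

section \<open>Truncation of integrable variables at level one\<close>

text \<open>
  The function \<open>w\<^sup>2\<close> for \<open>\<bar>w\<bar> \<le> 1\<close> and \<open>\<bar>w\<bar>\<close> beyond. Its expectation measures at once the second
  moment of the part of a variable below level one and the first moment of the part above, which are
  the two quantities that truncation at level one produces.
\<close>
definition quad_lin :: "real \<Rightarrow> real" where
  "quad_lin w = min (w\<^sup>2) \<bar>w\<bar>"

lemma quad_lin_nonneg [simp]: "0 \<le> quad_lin w"
  by (simp add: quad_lin_def)

lemma quad_lin_le_abs: "quad_lin w \<le> \<bar>w\<bar>"
  by (simp add: quad_lin_def)

lemma measurable_quad_lin [measurable]: "quad_lin \<in> borel_measurable borel"
  unfolding quad_lin_def[abs_def] by measurable

lemma quad_lin_of_abs_le_1: "\<bar>w\<bar> \<le> 1 \<Longrightarrow> quad_lin w = w\<^sup>2"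
  using mult_left_mono[of "\<bar>w\<bar>" 1 "\<bar>w\<bar>"] by (simp add: quad_lin_def min_def power2_eq_square)

lemma quad_lin_of_abs_ge_1: "1 \<le> \<bar>w\<bar> \<Longrightarrow> quad_lin w = \<bar>w\<bar>"
  using mult_left_mono[of 1 "\<bar>w\<bar>" "\<bar>w\<bar>"] by (simp add: quad_lin_def min_def power2_eq_square)

lemma quad_lin_mono: "\<bar>v\<bar> \<le> \<bar>w\<bar> \<Longrightarrow> quad_lin v \<le> quad_lin w"
  by (simp add: quad_lin_def min_le_iff_disj abs_le_square_iff)

definition trunc :: "real \<Rightarrow> real" where
  "trunc w = (if \<bar>w\<bar> \<le> 1 then w else 0)"

lemma measurable_trunc [measurable]: "trunc \<in> borel_measurable borel"
  unfolding trunc_def[abs_def] by measurable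

lemma trunc_power2_le: "(trunc w)\<^sup>2 \<le> quad_lin w"
  by (simp add: trunc_def quad_lin_of_abs_le_1)

lemma abs_diff_trunc_le: "\<bar>w - trunc w\<bar> \<le> quad_lin w"
  by (simp add: trunc_def quad_lin_of_abs_ge_1)

lemma (in prob_space) integrable_quad_lin:
  "integrable M W \<Longrightarrow> integrable M (\<lambda>\<omega>. quad_lin (W \<omega>))"
  by (rule Bochner_Integration.integrable_bound[of M W]) (auto simp: quad_lin_le_abs)

text \<open>
  A centered \<open>W\<close> splits into a centered bounded part \<open>U\<close> and a remainder \<open>W - U\<close>. The remainder
  contains the mean of the truncated variable; as \<open>W\<close> is centered, this is minus the mean of the
  discarded part, so it too is bounded by the expectation of \<open>quad_lin\<close>.
\<close>
lemma (in prob_space) centered_truncation: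
  fixes W :: "'a \<Rightarrow> real"
  assumes W: "integrable M W" and mean: "expectation W = 0"
  defines "U \<equiv> (\<lambda>\<omega>. trunc (W \<omega>) - expectation (\<lambda>\<omega>. trunc (W \<omega>)))"
  shows "integrable M U" "expectation U = 0" "integrable M (\<lambda>\<omega>. (U \<omega>)\<^sup>2)"
    and "expectation (\<lambda>\<omega>. (U \<omega>)\<^sup>2) \<le> expectation (\<lambda>\<omega>. quad_lin (W \<omega>))"
    and "expectation (\<lambda>\<omega>. \<bar>W \<omega> - U \<omega>\<bar>) \<le> 2 * expectation (\<lambda>\<omega>. quad_lin (W \<omega>))"
proof -
  have [measurable]: "W \<in> borel_measurable M" using W by auto
  define m where "m = expectation (\<lambda>\<omega>. trunc (W \<omega>))"
  have U: "U \<omega> = trunc (W \<omega>) - m" for \<omega> unfolding U_def m_def ..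
  have iq: "integrable M (\<lambda>\<omega>. quad_lin (W \<omega>))" by (rule integrable_quad_lin[OF W])
  have it: "integrable M (\<lambda>\<omega>. trunc (W \<omega>))"
    by (rule integrable_const_bound[of _ 1]) (auto simp: trunc_def)
  have it2: "integrable M (\<lambda>\<omega>. (trunc (W \<omega>))\<^sup>2)"
    by (rule integrable_const_bound[of _ 1]) (auto simp: trunc_def abs_square_le_1)
  have eq: "(U \<omega>)\<^sup>2 = (trunc (W \<omega>))\<^sup>2 - 2 * m * trunc (W \<omega>) + m\<^sup>2" for \<omega>
    by (simp add: U power2_diff algebra_simps)
  show "integrable M U" unfolding U using it by simp
  then have iWU: "integrable M (\<lambda>\<omega>. \<bar>W \<omega> - U \<omega>\<bar>)" using W by auto
  show "expectation U = 0" unfolding U using it by (simp add: m_def prob_space)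
  show "integrable M (\<lambda>\<omega>. (U \<omega>)\<^sup>2)" unfolding eq using it it2 by simp
  have "expectation (\<lambda>\<omega>. (U \<omega>)\<^sup>2) = expectation (\<lambda>\<omega>. (trunc (W \<omega>))\<^sup>2) - m\<^sup>2"
    unfolding eq using it it2 by (simp add: prob_space m_def[symmetric] power2_eq_square)
  also have "\<dots> \<le> expectation (\<lambda>\<omega>. (trunc (W \<omega>))\<^sup>2)" by simp
  also have "\<dots> \<le> expectation (\<lambda>\<omega>. quad_lin (W \<omega>))"
    by (rule integral_mono[OF it2 iq]) (rule trunc_power2_le)
  finally show "expectation (\<lambda>\<omega>. (U \<omega>)\<^sup>2) \<le> expectation (\<lambda>\<omega>. quad_lin (W \<omega>))" .
  have "\<bar>m\<bar> = \<bar>expectation (\<lambda>\<omega>. W \<omega> - trunc (W \<omega>))\<bar>"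
    using it W mean by (simp add: m_def)
  also have "\<dots> \<le> expectation (\<lambda>\<omega>. \<bar>W \<omega> - trunc (W \<omega>)\<bar>)"
    by (rule integral_abs_bound)
  also have "\<dots> \<le> expectation (\<lambda>\<omega>. quad_lin (W \<omega>))"
    using it W iq by (intro integral_mono) (auto simp: abs_diff_trunc_le)
  finally have m: "\<bar>m\<bar> \<le> expectation (\<lambda>\<omega>. quad_lin (W \<omega>))" .
  have "\<bar>W \<omega> - U \<omega>\<bar> \<le> quad_lin (W \<omega>) + \<bar>m\<bar>" for \<omega>
    using abs_diff_trunc_le[of "W \<omega>"] unfolding U by linarith
  then have "expectation (\<lambda>\<omega>. \<bar>W \<omega> - U \<omega>\<bar>) \<le> expectation (\<lambda>\<omega>. quad_lin (W \<omega>) + \<bar>m\<bar>)"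
    using iWU iq by (intro integral_mono) auto
  also have "\<dots> = expectation (\<lambda>\<omega>. quad_lin (W \<omega>)) + \<bar>m\<bar>"
    using iq by (simp add: prob_space)
  finally show "expectation (\<lambda>\<omega>. \<bar>W \<omega> - U \<omega>\<bar>) \<le> 2 * expectation (\<lambda>\<omega>. quad_lin (W \<omega>))"
    using m by linarith
qed

lemma (in prob_space) AE_summable_of_summable_expectation:
  fixes R :: "nat \<Rightarrow> 'a \<Rightarrow> real"
  assumes int: "\<And>j. integrable M (R j)"
    and summ: "summable (\<lambda>j. expectation (\<lambda>\<omega>. \<bar>R j \<omega>\<bar>))"
  shows "AE \<omega> in M. summable (\<lambda>j. R j \<omega>)"
proof -
  have [measurable]: "R i \<in> borel_measurable M" for i using int by auto
  have "(\<integral>\<^sup>+ \<omega>. (\<Sum>j. ennreal \<bar>R j \<omega>\<bar>) \<partial>M) = (\<Sum>j. \<integral>\<^sup>+ \<omega>. ennreal \<bar>R j \<omega>\<bar> \<partial>M)"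
    by (rule nn_integral_suminf) simp
  also have "\<dots> = (\<Sum>j. ennreal (expectation (\<lambda>\<omega>. \<bar>R j \<omega>\<bar>)))"
    using int by (subst nn_integral_eq_integral) auto
  also have "\<dots> = ennreal (\<Sum>j. expectation (\<lambda>\<omega>. \<bar>R j \<omega>\<bar>))"
    using summ by (intro suminf_ennreal2) auto
  finally have "(\<integral>\<^sup>+ \<omega>. (\<Sum>j. ennreal \<bar>R j \<omega>\<bar>) \<partial>M) \<noteq> \<infinity>" by simp
  then have "AE \<omega> in M. (\<Sum>j. ennreal \<bar>R j \<omega>\<bar>) \<noteq> \<infinity>"
    by (intro nn_integral_noteq_infinite) auto
  then show ?thesis
  proof eventually_elim
    case (elim \<omega>)
    then have "summable (\<lambda>j. \<bar>R j \<omega>\<bar>)" by (intro summable_suminf_not_top) auto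
    then show ?case by (rule summable_rabs_cancel)
  qed
qed

text \<open>
  The centered truncations have summable variances and the remainders converge absolutely in \<open>L\<^sup>1\<close>.
\<close>
lemma (in prob_space) AE_summable_of_summable_quad_lin:
  fixes W :: "nat \<Rightarrow> 'a \<Rightarrow> real"
  assumes ind: "indep_vars (\<lambda>_. borel) W UNIV"
    and int: "\<And>j. integrable M (W j)"
    and mean: "\<And>j. expectation (W j) = 0"
    and summ: "summable (\<lambda>j. expectation (\<lambda>\<omega>. quad_lin (W j \<omega>)))"
  shows "AE \<omega> in M. summable (\<lambda>j. W j \<omega>)"
proof -
  define U where "U j \<omega> = trunc (W j \<omega>) - expectation (\<lambda>\<omega>. trunc (W j \<omega>))" for j \<omega>
  note ct = centered_truncation[OF int mean, folded U_def]
  have "indep_vars (\<lambda>_. borel) U UNIV"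
    unfolding U_def[abs_def] by (rule indep_vars_compose2[OF ind]) measurable
  moreover have "summable (\<lambda>j. expectation (\<lambda>\<omega>. (U j \<omega>)\<^sup>2))"
    by (rule summable_comparison_test'[OF summ, of 0]) (use ct(4) in auto)
  ultimately have "AE \<omega> in M. summable (\<lambda>j. U j \<omega>)"
    using ct by (intro AE_summable_of_summable_variance) auto
  moreover have "summable (\<lambda>j. expectation (\<lambda>\<omega>. \<bar>W j \<omega> - U j \<omega>\<bar>))"
    by (rule summable_comparison_test'[OF summable_mult[OF summ, of 2], of 0]) (use ct(5) in auto)
  then have "AE \<omega> in M. summable (\<lambda>j. W j \<omega> - U j \<omega>)"
    using int ct(1) by (intro AE_summable_of_summable_expectation) auto
  ultimately show ?thesis
  proof eventually_elim
    case (elim \<omega>)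
    show ?case using summable_add[OF elim] by simp
  qed
qed

text \<open>
  The finite counterpart: the truncated parts are handled in \<open>L\<^sup>2\<close>, where independence gives
  \<open>sqrt S\<close>, and the remainders in \<open>L\<^sup>1\<close> by the triangle inequality.
\<close>
lemma (in prob_space) expectation_abs_sum_le_quad_lin:
  fixes W :: "'i \<Rightarrow> 'a \<Rightarrow> real"
  assumes fin: "finite I" and ind: "indep_vars (\<lambda>_. borel) W I"
    and int: "\<And>i. i \<in> I \<Longrightarrow> integrable M (W i)"
    and mean: "\<And>i. i \<in> I \<Longrightarrow> expectation (W i) = 0"
  defines "S \<equiv> \<Sum>i\<in>I. expectation (\<lambda>\<omega>. quad_lin (W i \<omega>))"
  shows "expectation (\<lambda>\<omega>. \<bar>\<Sum>i\<in>I. W i \<omega>\<bar>) \<le> sqrt S + 2 * S"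
proof -
  define U where "U i \<omega> = trunc (W i \<omega>) - expectation (\<lambda>\<omega>. trunc (W i \<omega>))" for i \<omega>
  note ct = centered_truncation[OF int mean, folded U_def]
  have indU: "indep_vars (\<lambda>_. borel) U I"
    unfolding U_def[abs_def] by (rule indep_vars_compose2[OF ind]) measurable
  define T where "T \<omega> = (\<Sum>i\<in>I. U i \<omega>)" for \<omega>
  have intT: "integrable M T" unfolding T_def[abs_def] using ct(1) by auto
  note T2 = second_moment_sum_indep_centered[OF fin indU ct(1) ct(3) ct(2), folded T_def]
  have "(expectation (\<lambda>\<omega>. \<bar>T \<omega>\<bar>))\<^sup>2 \<le> expectation (\<lambda>\<omega>. \<bar>T \<omega>\<bar>\<^sup>2)"
    using variance_eq[of "\<lambda>\<omega>. \<bar>T \<omega>\<bar>"] variance_positive[of "\<lambda>\<omega>. \<bar>T \<omega>\<bar>"] intT T2 by simp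
  also have "\<dots> \<le> S"
    using T2 ct(4) unfolding S_def by (auto intro!: sum_mono)
  finally have T: "expectation (\<lambda>\<omega>. \<bar>T \<omega>\<bar>) \<le> sqrt S" by (rule real_le_rsqrt)
  have "expectation (\<lambda>\<omega>. \<bar>\<Sum>i\<in>I. W i \<omega>\<bar>)
      \<le> expectation (\<lambda>\<omega>. \<bar>T \<omega>\<bar> + (\<Sum>i\<in>I. \<bar>W i \<omega> - U i \<omega>\<bar>))"
  proof (rule integral_mono)
    fix \<omega>
    have "(\<Sum>i\<in>I. W i \<omega>) = T \<omega> + (\<Sum>i\<in>I. W i \<omega> - U i \<omega>)"
      by (simp add: T_def sum_subtractf)
    then show "\<bar>\<Sum>i\<in>I. W i \<omega>\<bar> \<le> \<bar>T \<omega>\<bar> + (\<Sum>i\<in>I. \<bar>W i \<omega> - U i \<omega>\<bar>)"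
      using sum_abs[of "\<lambda>i. W i \<omega> - U i \<omega>" I] by linarith
  qed (use int ct(1) intT in auto)
  also have "\<dots> = expectation (\<lambda>\<omega>. \<bar>T \<omega>\<bar>) + (\<Sum>i\<in>I. expectation (\<lambda>\<omega>. \<bar>W i \<omega> - U i \<omega>\<bar>))"
    using int ct(1) intT by (subst Bochner_Integration.integral_add) auto
  also have "\<dots> \<le> sqrt S + (\<Sum>i\<in>I. 2 * expectation (\<lambda>\<omega>. quad_lin (W i \<omega>)))"
    using T ct(5) by (intro add_mono sum_mono) auto
  finally show ?thesis by (simp add: S_def sum_distrib_left)
qed

section \<open>Moments of variables with small tails\<close>

text \<open>
  This replaces the integration of tail probabilities: applied to multiples of indicators of tail
  events at dyadic levels, it bounds a moment by a series of tail probabilities. A function below one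
  of the nonnegative \<open>g k\<close> at each point is below their sum.
\<close>
lemma (in prob_space) expectation_le_suminf:
  fixes f :: "'a \<Rightarrow> real" and g :: "nat \<Rightarrow> 'a \<Rightarrow> real"
  assumes f: "integrable M f"
    and g: "\<And>k. integrable M (g k)" "\<And>k \<omega>. 0 \<le> g k \<omega>"
    and le: "\<And>\<omega>. \<omega> \<in> space M \<Longrightarrow> \<exists>k. f \<omega> \<le> g k \<omega>"
    and summ: "summable (\<lambda>k. expectation (g k))"
  shows "expectation f \<le> (\<Sum>k. expectation (g k))"
proof -
  have [measurable]: "g k \<in> borel_measurable M" for k using g by auto
  have "ennreal (expectation f) \<le> ennreal (expectation (\<lambda>\<omega>. max 0 (f \<omega>)))"
    using f by (intro ennreal_leI integral_mono) auto
  also have "\<dots> = (\<integral>\<^sup>+ \<omega>. ennreal (max 0 (f \<omega>)) \<partial>M)"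
    using f by (subst nn_integral_eq_integral) auto
  also have "\<dots> \<le> (\<integral>\<^sup>+ \<omega>. (\<Sum>k. ennreal (g k \<omega>)) \<partial>M)"
  proof (rule nn_integral_mono)
    fix \<omega> assume "\<omega> \<in> space M"
    then obtain k where k: "f \<omega> \<le> g k \<omega>" using le by blast
    have "ennreal (max 0 (f \<omega>)) \<le> (\<Sum>i\<in>{k}. ennreal (g i \<omega>))"
      using k g(2) by (auto intro!: ennreal_leI)
    also have "\<dots> \<le> (\<Sum>k. ennreal (g k \<omega>))" by (rule sum_le_suminf) auto
    finally show "ennreal (max 0 (f \<omega>)) \<le> (\<Sum>k. ennreal (g k \<omega>))" .
  qed
  also have "\<dots> = (\<Sum>k. \<integral>\<^sup>+ \<omega>. ennreal (g k \<omega>) \<partial>M)"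
    by (rule nn_integral_suminf) simp
  also have "\<dots> = (\<Sum>k. ennreal (expectation (g k)))"
    using g by (subst nn_integral_eq_integral) auto
  also have "\<dots> = ennreal (\<Sum>k. expectation (g k))"
    using summ g by (intro suminf_ennreal2) auto
  finally show ?thesis
    using suminf_nonneg[OF summ] g by (simp add: ennreal_le_iff)
qed

text \<open>
  The least exponent \<open>m\<close> with \<open>y \<le> 2 ^ m\<close> is positive because \<open>1 < y\<close>; its predecessor is the
  required \<open>k\<close>.
\<close>
lemma dyadic_bracket:
  fixes y :: real
  assumes "1 < y"
  shows "\<exists>k. 2 ^ k < y \<and> y \<le> 2 ^ Suc k"
proof -
  obtain n where "y < 2 ^ n" using real_arch_pow[of 2 y] by auto
  define m where "m = (LEAST m. y \<le> 2 ^ m)"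
  have m: "y \<le> 2 ^ m" unfolding m_def by (rule LeastI[of _ n]) (use \<open>y < 2 ^ n\<close> in simp)
  with assms obtain k where k: "m = Suc k" by (cases m) auto
  have "\<not> y \<le> 2 ^ k" using not_less_Least[of k "\<lambda>m. y \<le> 2 ^ m"] k unfolding m_def by auto
  with m k show ?thesis by (intro exI[of _ k]) auto
qed

text \<open>
  The first summand serves \<open>0 < \<bar>y\<bar> \<le> 1\<close>, where \<open>k\<close> is the dyadic scale of \<open>y\<close> downwards from one,
  and the second serves \<open>1 < \<bar>y\<bar>\<close>, with \<open>k\<close> the scale upwards from one.
\<close>
lemma quad_lin_le_dyadic:
  fixes y :: real
  shows "\<exists>k. quad_lin y \<le> (1/4)^k * (if (1/2)^Suc k < \<bar>y\<bar> then 1 else 0)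
    + 2^Suc k * (if 2^k < \<bar>y\<bar> then 1 else 0)"
proof -
  consider "y = 0" | "0 < \<bar>y\<bar>" "\<bar>y\<bar> \<le> 1" | "1 < \<bar>y\<bar>" by fastforce
  then show ?thesis
  proof cases
    case 1
    then show ?thesis by (auto simp: quad_lin_def)
  next
    case 2
    obtain k where k: "(1/2)^Suc k < \<bar>y\<bar>" "\<bar>y\<bar> \<le> (1/2)^k"
    proof (cases "\<bar>y\<bar> = 1")
      case True
      then show ?thesis using that[of 0] by simp
    next
      case False
      define m where "m = (LEAST m. (1/2)^m < \<bar>y\<bar>)"
      obtain n where n: "(1/2)^n < \<bar>y\<bar>" using real_arch_pow_inv[of "\<bar>y\<bar>" "1/2"] 2 by auto
      have m: "(1/2)^m < \<bar>y\<bar>" unfolding m_def by (rule LeastI[of _ n]) (rule n)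
      with 2 obtain k where k: "m = Suc k" by (cases m) auto
      have "\<not> (1/2)^k < \<bar>y\<bar>"
        using not_less_Least[of k "\<lambda>m. (1/2)^m < \<bar>y\<bar>"] k unfolding m_def by auto
      with m k show ?thesis using that[of k] by auto
    qed
    have "quad_lin y \<le> quad_lin ((1/2)^k)" using k by (intro quad_lin_mono) auto
    also have "\<dots> = (1/4)^k"
      by (subst quad_lin_of_abs_le_1) (auto simp: power_le_one power_mult[symmetric] power_divide power2_eq_square simp flip: power_mult_distrib)
    finally show ?thesis using k by (intro exI[of _ k]) (auto intro: add_increasing2)
  next
    case 3
    from dyadic_bracket[OF 3] obtain k where k: "2 ^ k < \<bar>y\<bar>" "\<bar>y\<bar> \<le> 2 ^ Suc k" by blast
    have "quad_lin y \<le> 2 ^ Suc k" using quad_lin_le_abs[of y] k by linarith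
    then show ?thesis using k by (intro exI[of _ k]) (auto intro: add_increasing)
  qed
qed

text \<open>
  This is where the tail condition enters; it says that \<open>E (quad_lin (c X)) = o(c powr p)\<close> as \<open>c\<close>
  tends to zero from the right. With \<open>h x = x powr p * P(\<bar>X\<bar> > x)\<close>, the dyadic bound for \<open>c X\<close> turns the
  expectation divided by \<open>c powr p\<close> into a series whose \<open>k\<close>-th term is a geometric factor times a
  value of \<open>h\<close> at a point of order \<open>1 / c\<close>. Below level one the geometric ratio is \<open>2 powr (p - 2)\<close>,
  above it is \<open>2 powr (1 - p)\<close>; both are less than one exactly because \<open>1 < p < 2\<close>. As \<open>h\<close> is
  bounded and tends to zero at infinity, dominated convergence for series gives the claim.
\<close>
lemma (in prob_space) quad_lin_moment_scaling:
  fixes X :: "'a \<Rightarrow> real"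
  assumes X: "integrable M X" and p: "1 < p" "p < 2"
    and tail: "((\<lambda>x. x powr p * prob {\<omega> \<in> space M. \<bar>X \<omega>\<bar> > x}) \<longlongrightarrow> 0) at_top"
    and "0 < \<eta>"
  shows "\<exists>\<delta>>0. \<forall>c. 0 \<le> c \<and> c \<le> \<delta> \<longrightarrow> expectation (\<lambda>\<omega>. quad_lin (c * X \<omega>)) \<le> \<eta> * c powr p"
proof -
  have [measurable]: "X \<in> borel_measurable M" using X by auto
  define h where "h x = x powr p * prob {\<omega> \<in> space M. \<bar>X \<omega>\<bar> > x}" for x
  have h0: "0 \<le> h x" for x by (simp add: h_def)
  have hlim: "(h \<longlongrightarrow> 0) at_top" using tail unfolding h_def .
  obtain K where K: "\<And>x. 0 < x \<Longrightarrow> h x \<le> K" "0 \<le> K"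
  proof -
    have "eventually (\<lambda>x. h x < 1) at_top" using hlim by (rule order_tendstoD) simp
    then obtain A where A: "\<And>x. A \<le> x \<Longrightarrow> h x < 1" by (auto simp: eventually_at_top_linorder)
    \<comment> \<open>Below \<open>A\<close> the probability is bounded by one, above \<open>A\<close> the tail condition applies.\<close>
    have "h x \<le> max 1 (\<bar>A\<bar> powr p)" if "0 < x" for x
    proof (cases "A \<le> x")
      case True
      then show ?thesis using A[of x] by auto
    next
      case False
      have "h x \<le> x powr p * 1" unfolding h_def by (intro mult_left_mono) auto
      also have "\<dots> \<le> \<bar>A\<bar> powr p" using False that p by (auto intro!: powr_mono2)
      finally show ?thesis by simp
    qed
    then show ?thesis using that[of "max 1 (\<bar>A\<bar> powr p)"] by auto
  qed
  define r s where "r = 2 powr (p - 2)" and "s = 2 powr (1 - p)"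
  have r: "0 < r" "r < 1" and s: "0 < s" "s < 1"
    using p unfolding r_def s_def by (auto simp: powr_less_one)
  define a where "a k c = 2 powr p * r^k * h ((1/2)^Suc k / c) + 2 * s^k * h (2^k / c)" for k c
  define B where "B k = 2 powr p * r^k * K + 2 * s^k * K" for k
  have sB: "summable B" unfolding B_def using r s
    by (intro summable_add summable_mult summable_mult2 summable_geometric) auto
  have aB: "0 \<le> a k c \<and> a k c \<le> B k" if "0 < c" for k c
    unfolding a_def B_def using that r s h0 K(1)[of "(1/2)^Suc k / c"] K(1)[of "2^k / c"]
    by (auto intro!: add_mono mult_left_mono)
  have alim: "((\<lambda>c. a k c) \<longlongrightarrow> 0) (at_right 0)" for k
  proof -
    have hl: "((\<lambda>c. h (t / c)) \<longlongrightarrow> 0) (at_right 0)" if "0 < t" for t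
    proof (rule filterlim_compose[OF hlim])
      show "filterlim ((/) t) at_top (at_right 0)" using that by real_asymp
    qed
    have "((\<lambda>c. a k c) \<longlongrightarrow> 2 powr p * r^k * 0 + 2 * s^k * 0) (at_right 0)"
      unfolding a_def by (intro tendsto_intros hl) auto
    then show ?thesis by simp
  qed
  have "((\<lambda>c. \<Sum>k. a k c) \<longlongrightarrow> (\<Sum>k. 0)) (at_right 0)"
  proof -
    have "eventually (\<lambda>(k,c). norm (a k c) \<le> B k) (at_top \<times>\<^sub>F at_right (0::real))"
      unfolding eventually_prod_filter
      by (intro exI[of _ "\<lambda>_. True"] exI[of _ "\<lambda>c. 0 < c"]) (auto simp: aB eventually_at_right_less)
    from tannerys_theorem[OF alim this sB] show ?thesis by auto
  qed
  then have "eventually (\<lambda>c. (\<Sum>k. a k c) < \<eta>) (at_right 0)"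
    using \<open>0 < \<eta>\<close> by (auto dest: order_tendstoD)
  then obtain b where b: "0 < b" "\<And>c. 0 < c \<Longrightarrow> c < b \<Longrightarrow> (\<Sum>k. a k c) < \<eta>"
    by (auto simp: eventually_at_right_field)
  have main: "expectation (\<lambda>\<omega>. quad_lin (c * X \<omega>)) \<le> c powr p * (\<Sum>k. a k c)" if c: "0 < c" for c
  proof -
    define g :: "nat \<Rightarrow> 'a \<Rightarrow> real" where "g k \<omega> = (1/4)^k * indicator {\<omega> \<in> space M. \<bar>X \<omega>\<bar> > (1/2)^Suc k / c} \<omega>
      + 2^Suc k * indicator {\<omega> \<in> space M. \<bar>X \<omega>\<bar> > 2^k / c} \<omega>" for k \<omega>
    have scale: "w * prob {\<omega> \<in> space M. \<bar>X \<omega>\<bar> > t / c} = c powr p * ((w * t powr - p) * h (t / c))"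
      if "0 < t" for w t
      using that c by (simp add: h_def powr_divide powr_minus field_simps)
    have pw: "(2 powr b) ^ k = 2 powr (b * real k)" for b :: real and k
      by (subst powr_powr[symmetric], rule powr_realpow[symmetric]) simp
    have Eg: "expectation (g k) = c powr p * a k c" for k
    proof -
      have r': "(1/4)^k * ((1/2)^Suc k) powr - p = 2 powr p * r^k"
      proof -
        have "(1/2::real)^Suc k = 2 powr (- real (Suc k))"
         
          unfolding powr_minus powr_realpow[OF zero_less_numeral] power_one_over inverse_eq_divide ..
        moreover have "(1/4::real)^k = 2 powr (- 2 * real k)"
          using pw[of "- 2" k] by (simp add: powr_minus)
        moreover have "r^k = 2 powr ((p - 2) * real k)"
          unfolding r_def by (rule pw)
        ultimately show ?thesis by (simp add: powr_powr powr_add[symmetric] algebra_simps)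
      qed
      have s': "2^Suc k * (2^k) powr - p = 2 * s^k"
      proof -
        have "s^k = 2 powr ((1 - p) * real k)"
          unfolding s_def by (rule pw)
        moreover have "(2::real)^k = 2 powr real k" by (simp add: powr_realpow)
        ultimately show ?thesis by (simp add: powr_powr powr_add[symmetric] algebra_simps)
      qed
      have "expectation (g k) = (1/4)^k * prob {\<omega> \<in> space M. \<bar>X \<omega>\<bar> > (1/2)^Suc k / c}
        + 2^Suc k * prob {\<omega> \<in> space M. \<bar>X \<omega>\<bar> > 2^k / c}"
        unfolding g_def
        by (subst Bochner_Integration.integral_add) (auto simp: emeasure_eq_measure)
      also have "\<dots> = c powr p * a k c"
        unfolding a_def by (subst (1 2) scale) (simp_all only: r' s' distrib_left, simp_all)
      finally show ?thesis .
    qed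
    have suma: "summable (\<lambda>k. a k c)"
      by (rule summable_comparison_test'[OF sB, of 0]) (use aB[OF c] in auto)
    have "expectation (\<lambda>\<omega>. quad_lin (c * X \<omega>)) \<le> (\<Sum>k. expectation (g k))"
    proof (rule expectation_le_suminf)
      show "integrable M (\<lambda>\<omega>. quad_lin (c * X \<omega>))" using X by (intro integrable_quad_lin) auto
      show "integrable M (g k)" for k unfolding g_def[abs_def]
        by (intro Bochner_Integration.integrable_add integrable_mult_right integrable_real_indicator)
          (auto simp: emeasure_eq_measure)
      show "0 \<le> g k \<omega>" for k \<omega> unfolding g_def by simp
      show "summable (\<lambda>k. expectation (g k))" unfolding Eg using suma by (rule summable_mult)
      fix \<omega> assume \<omega>: "\<omega> \<in> space M"
      have "t / c < \<bar>X \<omega>\<bar> \<longleftrightarrow> t < \<bar>c * X \<omega>\<bar>" for t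
        using c by (simp add: abs_mult field_simps)
      then have "g k \<omega> = (1/4)^k * (if (1/2)^Suc k < \<bar>c * X \<omega>\<bar> then 1 else 0)
          + 2^Suc k * (if 2^k < \<bar>c * X \<omega>\<bar> then 1 else 0)" for k
        using \<omega> by (simp only: g_def indicator_def of_bool_def mem_Collect_eq simp_thms)
      then show "\<exists>k. quad_lin (c * X \<omega>) \<le> g k \<omega>"
        using quad_lin_le_dyadic[of "c * X \<omega>"] by (simp only:)
    qed
    also have "\<dots> = c powr p * (\<Sum>k. a k c)"
      unfolding Eg using suma by (rule suminf_mult)
    finally show ?thesis .
  qed
  show ?thesis
  proof (intro exI[of _ "b/2"] conjI allI impI)
    fix c assume c: "0 \<le> c \<and> c \<le> b / 2"
    show "expectation (\<lambda>\<omega>. quad_lin (c * X \<omega>)) \<le> \<eta> * c powr p"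
    proof (cases "c = 0")
      case True
      then show ?thesis by (simp add: quad_lin_def)
    next
      case False
      then have "0 < c" "c < b" using c b(1) by auto
      then have "c powr p * (\<Sum>k. a k c) \<le> c powr p * \<eta>"
        using b(2)[of c] by (intro mult_left_mono) auto
      then show ?thesis using main[OF \<open>0 < c\<close>] by (simp add: mult.commute)
    qed
  qed (use b in auto)
qed

section \<open>Weights of the innovations in the partial sums\<close>

text \<open>
  The mean value theorem on a unit interval, from which sums of powers are compared with telescoping
  sums.
\<close>
lemma powr_increment:
  fixes x a :: real
  assumes "0 < x"
  shows "\<exists>z. x < z \<and> z < x + 1 \<and> (x + 1) powr a - x powr a = a * z powr (a - 1)"
proof -
  have "\<exists>z>x. z < x + 1 \<and> (x + 1) powr a - x powr a = (x + 1 - x) * (a * z powr (a - 1))"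
    using assms by (intro MVT2) (auto intro!: derivative_eq_intros)
  then show ?thesis by auto
qed

lemma sum_powr_minus_le:
  fixes d :: real
  assumes "0 < d" "d < 1"
  shows "(\<Sum>j<n. (real j + 1) powr - d) \<le> real n powr (1 - d) / (1 - d)"
proof (induction n)
  case 0
  then show ?case by simp
next
  case (Suc n)
  have "(1 - d) * (real n + 1) powr - d \<le> (real n + 1) powr (1 - d) - real n powr (1 - d)"
  proof (cases "n = 0")
    case True
    then show ?thesis using assms by simp
  next
    case False
    then obtain z where z: "real n < z" "z < real n + 1"
      "(real n + 1) powr (1 - d) - real n powr (1 - d) = (1 - d) * z powr (1 - d - 1)"
      using powr_increment[of "real n" "1 - d"] by auto
    have "(real n + 1) powr - d \<le> z powr - d"
      using z assms by (intro powr_mono2') auto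
    then show ?thesis using z assms by (simp add: mult_left_mono)
  qed
  then have "(real n + 1) powr - d \<le> (real n + 1) powr (1 - d) / (1 - d) - real n powr (1 - d) / (1 - d)"
    unfolding diff_divide_distrib[symmetric] using assms by (subst pos_le_divide_eq) (auto simp: mult.commute)
  then show ?case using Suc by (simp add: add.commute)
qed

lemma sum_powr_minus_tail_le:
  fixes q :: real
  assumes "1 < q" "1 \<le> n"
  shows "(\<Sum>m=n..<N. (real m + 1) powr - q) \<le> real n powr (1 - q) / (q - 1)"
proof -
  have "(\<Sum>m=n..<N. (real m + 1) powr - q) \<le> (real n powr (1 - q) - real N powr (1 - q)) / (q - 1)"
    if "n \<le> N" for N
    using that
  proof (induction N rule: dec_induct)
    case base
    then show ?case by simp
  next
    case (step m)
    obtain z where z: "real m < z" "z < real m + 1"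
      "(real m + 1) powr (1 - q) - real m powr (1 - q) = (1 - q) * z powr (1 - q - 1)"
      using powr_increment[of "real m" "1 - q"] step assms by auto
    have "(real m + 1) powr - q \<le> z powr - q"
      using z assms by (intro powr_mono2') auto
    then have "(q - 1) * (real m + 1) powr - q \<le> (q - 1) * z powr - q"
      using assms by (intro mult_left_mono) auto
    also have "\<dots> = real m powr (1 - q) - (real m + 1) powr (1 - q)"
      using z by (simp add: algebra_simps)
    finally have "(real m + 1) powr - q \<le> (real m powr (1 - q) - (real m + 1) powr (1 - q)) / (q - 1)"
      using assms by (simp add: field_simps)
    then show ?case
      using step by (simp add: diff_divide_distrib add.commute)
  qed
  moreover have "(real n powr (1 - q) - real N powr (1 - q)) / (q - 1) \<le> real n powr (1 - q) / (q - 1)"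
    using assms by (intro divide_right_mono) auto
  ultimately show ?thesis
    using assms by (cases "n \<le> N") (auto intro: order_trans)
qed

text \<open>
  The coefficient of the innovation \<open>\<epsilon> i\<close> in \<open>X 1 + ... + X n\<close> when \<open>\<psi> j = (j + 1) powr - d\<close>.
\<close>
definition window_weight :: "real \<Rightarrow> nat \<Rightarrow> int \<Rightarrow> real" where
  "window_weight d n i = (\<Sum>k=1..n. if i \<le> int k then (real_of_int (int k - i) + 1) powr - d else 0)"

lemma window_weight_nonneg: "0 \<le> window_weight d n i"
  unfolding window_weight_def by (intro sum_nonneg) auto

text \<open>
  A weight is a sum of \<open>n\<close> or fewer distinct consecutive values of \<open>\<psi>\<close>, so it is at most the sum of
  the \<open>n\<close> largest ones. For \<open>i \<le> 0\<close> the values start at \<open>\<psi> 1\<close> or later, and are compared one by one.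
\<close>
lemma window_weight_le:
  assumes d: "0 < d" "d < 1"
  shows "window_weight d n i \<le> real n powr (1 - d) / (1 - d)"
proof -
  have "window_weight d n i \<le> (\<Sum>j<n. (real j + 1) powr - d)"
  proof (cases "1 \<le> i")
    case True
    define a where "a = nat i"
    have a: "i = int a" "1 \<le> a" using True by (auto simp: a_def)
    have "window_weight d n i = (\<Sum>k\<in>{a..n}. (real (k - a) + 1) powr - d)"
      unfolding window_weight_def
      by (rule sum.mono_neutral_cong_right) (use a in \<open>auto simp: of_nat_diff\<close>)
    also have "\<dots> = (\<Sum>j\<in>(\<lambda>k. k - a) ` {a..n}. (real j + 1) powr - d)"
      by (subst sum.reindex) (auto simp: inj_on_def)
    also have "\<dots> \<le> (\<Sum>j<n. (real j + 1) powr - d)"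
      using a by (intro sum_mono2) auto
    finally show ?thesis .
  next
    case False
    have "window_weight d n i \<le> (\<Sum>k=1..n. (real (k - 1) + 1) powr - d)"
      unfolding window_weight_def
      by (intro sum_mono) (use False d in \<open>auto intro!: powr_mono2' simp: of_nat_diff\<close>)
    also have "\<dots> = (\<Sum>j<n. (real j + 1) powr - d)"
      by (rule sum.reindex_bij_witness[of _ Suc "\<lambda>k. k - 1"]) auto
    finally show ?thesis .
  qed
  then show ?thesis using sum_powr_minus_le[OF d, of n] by linarith
qed

lemma window_weight_far_le:
  assumes "0 < d"
  shows "window_weight d n (- int m) \<le> real n * (real m + 1) powr - d"
proof -
  have "window_weight d n (- int m) \<le> (\<Sum>k=1..n. (real m + 1) powr - d)"
    unfolding window_weight_def
    by (intro sum_mono) (use assms in \<open>auto intro!: powr_mono2'\<close>)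
  then show ?thesis by simp
qed

text \<open>
  The order \<open>1 + p * (1 - d)\<close> arises twice: the \<open>2 n\<close> indices above \<open>- n\<close> each contribute at most
  \<open>(n powr (1 - d)) powr p\<close> up to a constant, and the indices \<open>i = - m\<close> with \<open>n \<le> m\<close> contribute
  \<open>n powr p\<close> times a tail of the series of \<open>m powr - (d * p)\<close>, which converges because \<open>1 / p < d\<close>.
  The bound does not depend on \<open>N\<close>.
\<close>
lemma sum_window_weight_powr_le:
  assumes p: "1 < p" and d: "1 / p < d" "d < 1" and n: "1 \<le> n"
  shows "(\<Sum>i\<in>{- int N<..int n}. window_weight d n i powr p)
    \<le> (2 / (1 - d) powr p + 1 / (d * p - 1)) * real n powr (1 + p * (1 - d))"
proof -
  have d0: "0 < d" using p d by (meson divide_pos_pos less_trans zero_less_one)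
  have q: "1 < d * p" using p d by (simp add: field_simps)
  define w where "w i = window_weight d n i powr p" for i
  have w0: "0 \<le> w i" for i by (simp add: w_def)
  have "(\<Sum>i\<in>{- int N<..int n}. w i) \<le> (\<Sum>i\<in>{- int n<..int n} \<union> (\<lambda>m. - int m) ` {n..<N}. w i)"
  proof (intro sum_mono2 subsetI)
    fix i assume i: "i \<in> {- int N<..int n}"
    show "i \<in> {- int n<..int n} \<union> (\<lambda>m. - int m) ` {n..<N}"
    proof (cases "- int n < i")
      case False
      then have "i = - int (nat (- i))" "nat (- i) \<in> {n..<N}" using i by auto
      then show ?thesis by blast
    qed (use i in auto)
  qed (auto simp: w0)
  also have "\<dots> \<le> (\<Sum>i\<in>{- int n<..int n}. w i) + (\<Sum>i\<in>(\<lambda>m. - int m) ` {n..<N}. w i)"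
    by (subst sum.union_inter[symmetric]) (auto intro!: sum_nonneg simp: w0)
  also have "(\<Sum>i\<in>(\<lambda>m. - int m) ` {n..<N}. w i) = (\<Sum>m\<in>{n..<N}. w (- int m))"
    by (subst sum.reindex) (auto simp: inj_on_def)
  also have "\<dots> \<le> (\<Sum>m\<in>{n..<N}. real n powr p * (real m + 1) powr - (d * p))"
  proof (rule sum_mono)
    fix m
    have "w (- int m) \<le> (real n * (real m + 1) powr - d) powr p"
      unfolding w_def using window_weight_far_le[OF d0] window_weight_nonneg p
      by (intro powr_mono2) auto
    then show "w (- int m) \<le> real n powr p * (real m + 1) powr - (d * p)"
      by (simp add: powr_mult powr_powr)
  qed
  also have "\<dots> \<le> real n powr p * (real n powr (1 - d * p) / (d * p - 1))"
    unfolding sum_distrib_left[symmetric] using q n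
    by (intro mult_left_mono sum_powr_minus_tail_le) auto
  also have "\<dots> = 1 / (d * p - 1) * real n powr (1 + p * (1 - d))"
    by (simp add: powr_add[symmetric] algebra_simps)
  also have "(\<Sum>i\<in>{- int n<..int n}. w i) \<le> (\<Sum>i\<in>{- int n<..int n}. (real n powr (1 - d) / (1 - d)) powr p)"
    unfolding w_def using window_weight_le[OF d0 d(2)] window_weight_nonneg p
    by (intro sum_mono powr_mono2) auto
  also have "\<dots> = 2 * real n * (real n powr (p * (1 - d)) / (1 - d) powr p)"
    using d by (simp add: powr_divide powr_powr mult.commute)
  also have "\<dots> = 2 / (1 - d) powr p * real n powr (1 + p * (1 - d))"
    using n by (simp add: powr_add)
  finally show ?thesis by (simp add: w_def distrib_right)
qed

text \<open>
  The inner sums are cut off at \<open>j < N + k\<close> rather than at a common length so that all of them use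
  exactly the innovations with index above \<open>- N\<close>; then the weights do not depend on \<open>N\<close>.
\<close>
lemma sum_moving_average_eq_window:
  fixes e :: "int \<Rightarrow> real"
  shows "(\<Sum>k=1..n. \<Sum>j<N + k. (real j + 1) powr - d * e (int k - int j))
    = (\<Sum>i\<in>{- int N<..int n}. window_weight d n i * e i)"
proof -
  have "(\<Sum>j<N + k. (real j + 1) powr - d * e (int k - int j))
    = (\<Sum>i\<in>{- int N<..int n}. (if i \<le> int k then (real_of_int (int k - i) + 1) powr - d else 0) * e i)"
    if "k \<in> {1..n}" for k
  proof -
    have "(\<Sum>j<N + k. (real j + 1) powr - d * e (int k - int j))
      = (\<Sum>i\<in>{- int N<..int k}. (real_of_int (int k - i) + 1) powr - d * e i)"
      by (rule sum.reindex_bij_witness[of _ "\<lambda>i. nat (int k - i)" "\<lambda>j. int k - int j"]) auto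
    also have "\<dots> = (\<Sum>i\<in>{- int N<..int n}.
        (if i \<le> int k then (real_of_int (int k - i) + 1) powr - d else 0) * e i)"
      by (rule sum.mono_neutral_cong_left) (use that in auto)
    finally show ?thesis .
  qed
  then show ?thesis
    unfolding window_weight_def sum_distrib_right by (subst sum.swap) (rule sum.cong[OF refl])
qed

section \<open>Convergence in probability of the partial sums\<close>

text \<open>
  Markov's inequality for an almost sure limit: by Fatou's lemma a uniform bound on the first
  absolute moments passes to the limit.
\<close>
lemma (in prob_space) prob_abs_limit_gt_le:
  fixes Y :: "nat \<Rightarrow> 'a \<Rightarrow> real" and Z :: "'a \<Rightarrow> real"
  assumes Y: "\<And>N. integrable M (Y N)" and [measurable]: "Z \<in> borel_measurable M"
    and lim: "AE \<omega> in M. (\<lambda>N. Y N \<omega>) \<longlonglongrightarrow> Z \<omega>"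
    and K: "\<And>N. expectation (\<lambda>\<omega>. \<bar>Y N \<omega>\<bar>) \<le> K" and e: "0 < e"
  shows "prob {\<omega> \<in> space M. \<bar>Z \<omega>\<bar> > e} \<le> K / e"
proof -
  have [measurable]: "Y N \<in> borel_measurable M" for N using Y by auto
  have "0 \<le> expectation (\<lambda>\<omega>. \<bar>Y 0 \<omega>\<bar>)" by simp
  then have K0: "0 \<le> K" using K[of 0] by linarith
  have "(\<integral>\<^sup>+ \<omega>. ennreal \<bar>Z \<omega>\<bar> \<partial>M) = (\<integral>\<^sup>+ \<omega>. liminf (\<lambda>N. ennreal \<bar>Y N \<omega>\<bar>) \<partial>M)"
  proof (rule nn_integral_cong_AE, use lim in eventually_elim)
    case (elim \<omega>)
    have "(\<lambda>N. ennreal \<bar>Y N \<omega>\<bar>) \<longlonglongrightarrow> ennreal \<bar>Z \<omega>\<bar>"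
      using elim by (intro tendsto_ennrealI tendsto_rabs)
    then show ?case by (rule lim_imp_Liminf[OF trivial_limit_sequentially, symmetric])
  qed
  also have "\<dots> \<le> liminf (\<lambda>N. \<integral>\<^sup>+ \<omega>. ennreal \<bar>Y N \<omega>\<bar> \<partial>M)"
    by (rule nn_integral_liminf) simp
  also have "\<dots> \<le> ennreal K"
  proof -
    have "(\<integral>\<^sup>+ \<omega>. ennreal \<bar>Y N \<omega>\<bar> \<partial>M) \<le> ennreal K" for N
      using Y K[of N] by (subst nn_integral_eq_integral) (auto intro: ennreal_leI)
    then show ?thesis
      by (intro order_trans[OF Liminf_le_Limsup Limsup_bounded]) auto
  qed
  finally have Z: "(\<integral>\<^sup>+ \<omega>. ennreal \<bar>Z \<omega>\<bar> \<partial>M) \<le> ennreal K" .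
  have "emeasure M {\<omega> \<in> space M. \<bar>Z \<omega>\<bar> > e} \<le> emeasure M {\<omega> \<in> space M. 1 \<le> ennreal (1 / e) * ennreal \<bar>Z \<omega>\<bar>}"
  proof (rule emeasure_mono)
    have "1 \<le> ennreal (1 / e) * ennreal \<bar>Z \<omega>\<bar>" if "\<bar>Z \<omega>\<bar> > e" for \<omega>
    proof -
      have "ennreal 1 \<le> ennreal (1 / e * \<bar>Z \<omega>\<bar>)"
        using that e by (intro ennreal_leI) (simp add: field_simps)
      also have "\<dots> = ennreal (1 / e) * ennreal \<bar>Z \<omega>\<bar>"
        by (rule ennreal_mult) (use e in auto)
      finally show ?thesis by simp
    qed
    then show "{\<omega> \<in> space M. \<bar>Z \<omega>\<bar> > e} \<subseteq> {\<omega> \<in> space M. 1 \<le> ennreal (1 / e) * ennreal \<bar>Z \<omega>\<bar>}"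
      by blast
  qed measurable
  also have "\<dots> \<le> ennreal (1 / e) * (\<integral>\<^sup>+ \<omega>. ennreal \<bar>Z \<omega>\<bar> * indicator (space M) \<omega> \<partial>M)"
    by (rule nn_integral_Markov_inequality) auto
  also have "(\<integral>\<^sup>+ \<omega>. ennreal \<bar>Z \<omega>\<bar> * indicator (space M) \<omega> \<partial>M) = (\<integral>\<^sup>+ \<omega>. ennreal \<bar>Z \<omega>\<bar> \<partial>M)"
    by (rule nn_integral_cong) simp
  also have "ennreal (1 / e) * \<dots> \<le> ennreal (1 / e) * ennreal K"
    by (rule mult_left_mono[OF Z]) simp
  also have "\<dots> = ennreal (K / e)"
    using e K0 by (simp add: ennreal_mult[symmetric])
  finally show ?thesis
    using e K0 by (simp add: emeasure_eq_measure ennreal_le_iff)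
qed

theorem corollary1:
  fixes M :: "'a measure" and \<epsilon> :: "int \<Rightarrow> 'a \<Rightarrow> real" and \<psi> :: "nat \<Rightarrow> real" and p d :: real
  assumes "prob_space M"
    and "1 < p" and "p < 2"
    and "prob_space.indep_vars M (\<lambda>_. borel) \<epsilon> UNIV"
    and "\<And>k. distr M borel (\<epsilon> k) = distr M borel (\<epsilon> 0)"
    and "((\<lambda>x. x powr p * measure M {\<omega> \<in> space M. \<bar>\<epsilon> 0 \<omega>\<bar> > x}) \<longlongrightarrow> 0) at_top"
    and "has_bochner_integral M (\<epsilon> 0) 0"
    and "1 / p < d" and "d < 1"
    and "\<And>j. \<psi> j = (real j + 1) powr (- d)"
  shows "(\<forall>k. AE \<omega> in M. summable (\<lambda>j. \<psi> j * \<epsilon> (k - int j) \<omega>)) \<and>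
    tendsto_in_prob M
      (\<lambda>n \<omega>. partial_sum (linear_process \<psi> \<epsilon>) n \<omega> / real n powr (1 / p + 1 - d)) (\<lambda>_. 0)"
proof -
  interpret prob_space M by fact
  note p = \<open>1 < p\<close> \<open>p < 2\<close> and d = \<open>1 / p < d\<close> \<open>d < 1\<close> and ind = assms(4) and \<psi> = assms(10)
  have d0: "0 < d" using p d by (meson divide_pos_pos less_trans zero_less_one)
  have dp: "1 < d * p" using p d by (simp add: field_simps)
  have int0: "integrable M (\<epsilon> 0)" "expectation (\<epsilon> 0) = 0"
    using assms(7) by (auto simp: has_bochner_integral_iff)
  have [measurable]: "\<epsilon> k \<in> borel_measurable M" for k
    using ind unfolding indep_vars_def by blast
  have int: "integrable M (\<epsilon> k)" for k
  proof -
    have "integrable (distr M borel (\<epsilon> 0)) (\<lambda>x. x)"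
      by (subst integrable_distr_eq) (use int0 in auto)
    then have "integrable (distr M borel (\<epsilon> k)) (\<lambda>x. x)"
      by (subst assms(5))
    then show ?thesis
      by (subst (asm) integrable_distr_eq) auto
  qed
  have same: "expectation (\<lambda>\<omega>. f (\<epsilon> k \<omega>)) = expectation (\<lambda>\<omega>. f (\<epsilon> 0 \<omega>))"
    if f: "f \<in> borel_measurable borel" for f :: "real \<Rightarrow> real" and k
  proof -
    have "expectation (\<lambda>\<omega>. f (\<epsilon> k \<omega>)) = integral\<^sup>L (distr M borel (\<epsilon> k)) f"
      by (rule integral_distr[symmetric, OF _ f]) simp
    also have "\<dots> = integral\<^sup>L (distr M borel (\<epsilon> 0)) f"
      by (subst assms(5)) (rule refl)
    also have "\<dots> = expectation (\<lambda>\<omega>. f (\<epsilon> 0 \<omega>))"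
      by (rule integral_distr[OF _ f]) simp
    finally show ?thesis .
  qed
  have mean: "expectation (\<epsilon> k) = 0" for k
  proof -
    have "expectation (\<epsilon> k) = expectation (\<epsilon> 0)" by (rule same) simp
    then show ?thesis unfolding int0(2) .
  qed
  \<comment> \<open>By identical distribution one \<open>\<delta>\<close> serves all innovations.\<close>
  have small: "\<exists>\<delta>>0. \<forall>c k. 0 \<le> c \<and> c \<le> \<delta> \<longrightarrow> expectation (\<lambda>\<omega>. quad_lin (c * \<epsilon> k \<omega>)) \<le> \<eta> * c powr p"
    if "0 < \<eta>" for \<eta>
  proof -
    obtain \<delta> where \<delta>: "0 < \<delta>"
      "\<And>c. 0 \<le> c \<Longrightarrow> c \<le> \<delta> \<Longrightarrow> expectation (\<lambda>\<omega>. quad_lin (c * \<epsilon> 0 \<omega>)) \<le> \<eta> * c powr p"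
      using quad_lin_moment_scaling[OF int0(1) p assms(6) \<open>0 < \<eta>\<close>] by auto
    have "expectation (\<lambda>\<omega>. quad_lin (c * \<epsilon> k \<omega>)) \<le> \<eta> * c powr p" if "0 \<le> c" "c \<le> \<delta>" for c k
    proof -
      have "expectation (\<lambda>\<omega>. quad_lin (c * \<epsilon> k \<omega>)) = expectation (\<lambda>\<omega>. quad_lin (c * \<epsilon> 0 \<omega>))"
        by (rule same[of "\<lambda>x. quad_lin (c * x)"]) measurable
      also note \<delta>(2)[OF that]
      finally show ?thesis .
    qed
    with \<delta>(1) show ?thesis by blast
  qed

  have conv: "AE \<omega> in M. summable (\<lambda>j. \<psi> j * \<epsilon> (k - int j) \<omega>)" for k
  proof (rule AE_summable_of_summable_quad_lin)
    have "indep_vars (\<lambda>_. borel) (\<lambda>j. \<epsilon> (k - int j)) UNIV"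
      by (rule indep_vars_reindex_inj[OF ind]) (auto simp: inj_on_def)
    then show "indep_vars (\<lambda>_. borel) (\<lambda>j \<omega>. \<psi> j * \<epsilon> (k - int j) \<omega>) UNIV"
      by (rule indep_vars_compose2) simp
    obtain \<delta> where \<delta>: "0 < \<delta>"
      "\<And>c k. 0 \<le> c \<Longrightarrow> c \<le> \<delta> \<Longrightarrow> expectation (\<lambda>\<omega>. quad_lin (c * \<epsilon> k \<omega>)) \<le> 1 * c powr p"
      using small[of 1] by auto
    have "(\<lambda>j. \<psi> j) \<longlonglongrightarrow> 0"
      unfolding \<psi> by (rule tendsto_neg_powr) (use d0 in simp, real_asymp)
    then have "eventually (\<lambda>j. \<psi> j < \<delta>) sequentially" using \<delta>(1) by (rule order_tendstoD)
    then have ev: "eventually (\<lambda>j. norm (expectation (\<lambda>\<omega>. quad_lin (\<psi> j * \<epsilon> (k - int j) \<omega>)))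
        \<le> (real j + 1) powr - (d * p)) sequentially"
    proof eventually_elim
      case (elim j)
      have "0 \<le> \<psi> j" by (simp add: \<psi>)
      then have "expectation (\<lambda>\<omega>. quad_lin (\<psi> j * \<epsilon> (k - int j) \<omega>)) \<le> \<psi> j powr p"
        using \<delta>(2)[of "\<psi> j" "k - int j"] elim by simp
      then show ?case by (simp add: \<psi> powr_powr)
    qed
    have "summable (\<lambda>j. real (Suc j) powr - (d * p))"
      using dp by (subst summable_Suc_iff) (simp add: summable_real_powr_iff)
    then have "summable (\<lambda>j. (real j + 1) powr - (d * p))" by (simp add: add.commute)
    with ev show "summable (\<lambda>j. expectation (\<lambda>\<omega>. quad_lin (\<psi> j * \<epsilon> (k - int j) \<omega>)))"
      by (rule summable_comparison_test_ev)
  qed (use int mean in auto)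

  define B where "B n = real n powr (1 / p + 1 - d)" for n
  define Z where "Z n \<omega> = partial_sum (linear_process \<psi> \<epsilon>) n \<omega> / B n" for n \<omega>
  have Z_meas [measurable]: "Z n \<in> borel_measurable M" for n
    unfolding Z_def partial_sum_def linear_process_def by measurable
  \<comment> \<open>The normalised weights \<open>c n i\<close> below have \<open>p\<close>-th powers summing to at most \<open>C\<close>.\<close>
  define C where "C = 2 / (1 - d) powr p + 1 / (d * p - 1)"
  have C: "0 < C" using dp d unfolding C_def by (intro add_pos_pos divide_pos_pos) auto

  define c where "c n i = window_weight d n i / B n" for n i
  \<comment> \<open>\<open>Y n N\<close> is the contribution of the innovations with index above \<open>- N\<close> to \<open>Z n\<close>.\<close>
  define Y where "Y n N \<omega> = (\<Sum>i\<in>{- int N<..int n}. c n i * \<epsilon> i \<omega>)" for n N \<omega>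
  have c0: "0 \<le> c n i" for n i
    unfolding c_def B_def by (simp add: window_weight_nonneg)
  have lim: "AE \<omega> in M. (\<lambda>N. Y n N \<omega>) \<longlonglongrightarrow> Z n \<omega>" for n
  proof -
    have "AE \<omega> in M. \<forall>k. summable (\<lambda>j. \<psi> j * \<epsilon> (k - int j) \<omega>)"
      using conv by (simp add: AE_all_countable)
    then show ?thesis
    proof eventually_elim
      case (elim \<omega>)
      have "(\<lambda>N. \<Sum>j<N + k. \<psi> j * \<epsilon> (int k - int j) \<omega>) \<longlonglongrightarrow> linear_process \<psi> \<epsilon> (int k) \<omega>" for k
        using LIMSEQ_ignore_initial_segment[OF summable_LIMSEQ[OF elim[rule_format, of "int k"]], of k]
        unfolding linear_process_def .
      then have "(\<lambda>N. (\<Sum>k=1..n. \<Sum>j<N + k. \<psi> j * \<epsilon> (int k - int j) \<omega>) / B n) \<longlonglongrightarrow> Z n \<omega>"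
        unfolding Z_def partial_sum_def divide_inverse by (intro tendsto_intros)
      moreover have "(\<Sum>k=1..n. \<Sum>j<N + k. \<psi> j * \<epsilon> (int k - int j) \<omega>) / B n = Y n N \<omega>" for N
        unfolding \<psi> sum_moving_average_eq_window[where e = "\<lambda>i. \<epsilon> i \<omega>"] Y_def c_def
        by (simp add: sum_divide_distrib)
      ultimately show ?case by simp
    qed
  qed
  have intY: "integrable M (Y n N)" for n N
    unfolding Y_def using int by auto

  have sum_c: "(\<Sum>i\<in>{- int N<..int n}. c n i powr p) \<le> C" if "1 \<le> n" for n N
  proof -
    have "(\<Sum>i\<in>{- int N<..int n}. c n i powr p)
      = (\<Sum>i\<in>{- int N<..int n}. window_weight d n i powr p) / B n powr p"
      unfolding c_def sum_divide_distrib
      by (intro sum.cong) (auto simp: powr_divide window_weight_nonneg B_def)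
    also have "\<dots> \<le> C * real n powr (1 + p * (1 - d)) / B n powr p"
      unfolding C_def by (intro divide_right_mono sum_window_weight_powr_le p d that) auto
    also have "B n powr p = real n powr (1 + p * (1 - d))"
    proof -
      have "(1 / p + 1 - d) * p = 1 + p * (1 - d)" using p by (simp add: field_simps)
      then show ?thesis by (simp add: B_def powr_powr)
    qed
    finally show ?thesis using that by simp
  qed
  \<comment> \<open>The weights become uniformly small, so the estimate \<open>small\<close> applies to all of them at once.\<close>
  have c_le: "c n i \<le> real n powr (- 1 / p) / (1 - d)" if "1 \<le> n" for n i
  proof -
    have "c n i \<le> real n powr (1 - d) / (1 - d) / B n"
      unfolding c_def by (intro divide_right_mono window_weight_le d0 d) (simp add: B_def)
    also have "\<dots> = (real n powr (1 - d) / B n) / (1 - d)" by simp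
    also have "real n powr (1 - d) / B n = real n powr (- 1 / p)"
      unfolding B_def powr_diff[symmetric] by simp
    finally show ?thesis .
  qed

  have "(\<lambda>n. prob {\<omega> \<in> space M. \<bar>Z n \<omega>\<bar> > e}) \<longlonglongrightarrow> 0" if "0 < e" for e
  proof (rule order_tendstoI)
    fix a :: real assume "a < 0"
    then show "eventually (\<lambda>n. a < prob {\<omega> \<in> space M. \<bar>Z n \<omega>\<bar> > e}) sequentially"
      by (auto intro!: always_eventually less_le_trans[of a 0])
  next
    fix a :: real assume a: "0 < a"
    \<comment> \<open>The expected modulus of \<open>Z n\<close> will be at most \<open>sqrt (\<eta> * C) + 2 * (\<eta> * C)\<close>; choose \<open>\<eta>\<close> accordingly.\<close>
    have "((\<lambda>\<eta>. (sqrt (\<eta> * C) + 2 * (\<eta> * C)) / e) \<longlongrightarrow> (sqrt (0 * C) + 2 * (0 * C)) / e) (at_right 0)"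
      using that by (intro tendsto_intros) auto
    then have "eventually (\<lambda>\<eta>. (sqrt (\<eta> * C) + 2 * (\<eta> * C)) / e < a) (at_right 0)"
      using a by (intro order_tendstoD) auto
    then have "eventually (\<lambda>\<eta>. 0 < \<eta> \<and> (sqrt (\<eta> * C) + 2 * (\<eta> * C)) / e < a) (at_right 0)"
      using eventually_at_right_less[of "0::real"] by eventually_elim auto
    then obtain \<eta> where \<eta>: "0 < \<eta>" "(sqrt (\<eta> * C) + 2 * (\<eta> * C)) / e < a"
      using eventually_happens'[OF trivial_limit_at_right_real] by blast
    obtain \<delta> where \<delta>: "0 < \<delta>"
      "\<And>c k. 0 \<le> c \<Longrightarrow> c \<le> \<delta> \<Longrightarrow> expectation (\<lambda>\<omega>. quad_lin (c * \<epsilon> k \<omega>)) \<le> \<eta> * c powr p"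
      using small[OF \<eta>(1)] by auto
    have "(\<lambda>n. real n powr (- 1 / p) / (1 - d)) \<longlonglongrightarrow> 0 / (1 - d)"
    proof (intro tendsto_divide tendsto_const)
      show "(\<lambda>n. real n powr (- 1 / p)) \<longlonglongrightarrow> 0"
        by (rule tendsto_neg_powr) (use p in \<open>auto simp: filterlim_real_sequentially\<close>)
    qed (use d in auto)
    then have "eventually (\<lambda>n. real n powr (- 1 / p) / (1 - d) < \<delta>) sequentially"
      using \<delta>(1) by (intro order_tendstoD) auto
    then show "eventually (\<lambda>n. prob {\<omega> \<in> space M. \<bar>Z n \<omega>\<bar> > e} < a) sequentially"
      using eventually_ge_at_top[of 1]
    proof eventually_elim
      case (elim n)
      have bound: "expectation (\<lambda>\<omega>. \<bar>Y n N \<omega>\<bar>) \<le> sqrt (\<eta> * C) + 2 * (\<eta> * C)" for N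
      proof -
        define I where "I = {- int N<..int n}"
        define S where "S = (\<Sum>i\<in>I. expectation (\<lambda>\<omega>. quad_lin (c n i * \<epsilon> i \<omega>)))"
        have "S \<le> (\<Sum>i\<in>I. \<eta> * c n i powr p)"
          unfolding S_def
        proof (rule sum_mono)
          fix i
          show "expectation (\<lambda>\<omega>. quad_lin (c n i * \<epsilon> i \<omega>)) \<le> \<eta> * c n i powr p"
            using c_le[OF elim(2), of i] elim(1) by (intro \<delta>(2) c0) auto
        qed
        also have "\<dots> \<le> \<eta> * C"
          unfolding sum_distrib_left[symmetric] I_def using \<eta>(1) sum_c[OF elim(2)]
          by (intro mult_left_mono) auto
        finally have S: "S \<le> \<eta> * C" .
        have "indep_vars (\<lambda>_. borel) (\<lambda>i \<omega>. c n i * \<epsilon> i \<omega>) I"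
          by (rule indep_vars_compose2[OF indep_vars_subset[OF ind]]) auto
        then have "expectation (\<lambda>\<omega>. \<bar>\<Sum>i\<in>I. c n i * \<epsilon> i \<omega>\<bar>) \<le> sqrt S + 2 * S"
          unfolding S_def using int mean
          by (intro expectation_abs_sum_le_quad_lin) (auto simp: I_def)
        also have "\<dots> \<le> sqrt (\<eta> * C) + 2 * (\<eta> * C)"
          using S by (intro add_mono mult_left_mono) auto
        finally show ?thesis by (simp add: Y_def I_def)
      qed
      show ?case
        using prob_abs_limit_gt_le[OF intY Z_meas lim bound that] \<eta>(2) by (rule le_less_trans)
    qed
  qed
  then show ?thesis
    using conv Z_meas unfolding tendsto_in_prob_def Z_def B_def by auto
qed

end
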